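(* Let $X,\widetilde{X}\in\mathbb{R}^{m\times N}$, where every column of $\widetilde X$ is nonzero, let $w\in\mathbb{R}^N$, and let $\mathcal{A}\subset\mathbb{R}$ be a finite nonempty set with associated round-to-nearest operator $\mathcal{Q}$. Define iterates $(q_t, w^{(t-1)}_{\geq t})$, $t=1,\dots,N$, by the initialization $w^{(0)}_{\geq 1}=w$ and, for $t=1,\dots,N$, \begin{align*} q_t &= \underset{p \in \mathcal{A}}{\arg\min}\ \tfrac{1}{2} \Big\| Xw - \sum_{j=1}^{t-1} q_j \widetilde{X}_j - p \widetilde{X}_t - \sum_{j=t+1}^{N} w^{(t-1)}_j \widetilde{X}_j \Big\|^2,\\ w^{(t)}_{\geq t+1} &= \underset{(v_{t+1}, \dots, v_N) \in \mathbb{R}^{N - t}}{\arg\min}\ \tfrac{1}{2} \Big\| Xw - \sum_{j=1}^{t} q_j \widetilde{X}_j - \sum_{j=t+1}^{N} v_j \widetilde{X}_j \Big\|^2 . \end{align*} Define an alternative sequence $(\hat{q}_t, \hat{w}^{(t-1)}_{\geq t})$, $t=1,\dots,N$, with the same initialization $\hat{w}^{(0)}_{\geq 1} = w$, by setting \begin{align*} \hat{q}_1 &= \underset{p \in \mathcal{A}}{\arg\min}\ \tfrac{1}{2} \Big\| Xw - p\widetilde{X}_1 - \sum_{j=2}^{N} w_j \widetilde{X}_j \Big\|^2,\\ \hat{w}^{(1)}_{\geq 2} &= \underset{(v_2, \dots, v_N) \in \mathbb{R}^{N-1}}{\arg\min}\ \tfrac{1}{2} \Big\| Xw - \hat{q}_1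 \widetilde{X}_1 - \sum_{j=2}^{N} v_j \widetilde{X}_j\Big\|^2, \end{align*} and, for $t = 2, \dots, N$, \begin{align*} \hat{q}_t &= \mathcal{Q}\big(\hat{w}^{(t-1)}_t\big),\\ \hat{w}^{(t)}_{\geq t+1} &= \underset{(v_{t+1}, \dots, v_N) \in \mathbb{R}^{N - t}}{\arg\min}\ \tfrac{1}{2} \Big\| \big(\hat{q}_t - \hat{w}^{(t-1)}_t\big)\widetilde{X}_t + \sum_{j = t+1}^{N} \big(v_j - \hat{w}^{(t-1)}_j\big)\widetilde{X}_j \Big\|^2 . \end{align*} Then for every $t = 1, \dots, N$ the two procedures yield identical iterates: $(q_t, w^{(t-1)}_{\geq t}) = (\hat{q}_t, \hat{w}^{(t-1)}_{\geq t})$.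
   Context: Indices start at 1. $\|\cdot\|$ is the Euclidean norm. For a matrix $A$, $A_j$ denotes its $j$-th column. For a vector $v$ indexed up to $N$, $v_{\ge t}=(v_t,\dots,v_N)^\top$. The vector $w^{(t-1)}_{\ge t}=(w^{(t-1)}_t,\dots,w^{(t-1)}_N)\in\mathbb{R}^{N-t+1}$ is indexed by $t,\dots,N$ (similarly with hats); for $t=N$ the weight updates are vacuous. $\mathcal{A}\subset\mathbb{R}$ is the (finite, nonempty) quantization grid and $\mathcal{Q}:\mathbb{R}\to\mathcal{A}$ is the round-to-nearest operator: $\mathcal{Q}(x)$ is an element of $\mathcal{A}$ closest to $x$. Ties between two elements of $\mathcal{A}$ are resolved by a fixed rule that selects one element from any pair of elements of $\mathcal{A}$; the same rule is used in $\mathcal{Q}$ and in every $\arg\min_{p\in\mathcal{A}}$. An $\arg\min$ over a real vector space of a least-squares objective $\frac12\|b-Bv\|^2$ denotes the minimizer $v=B^\dagger b$ ($B^\dagger$ the Moore–Penrose pseudoinverse), i.e. the minimizer of smallest Euclidean norm, which is the unique minimizer when $B$ has full column rank. *)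

theory Defs
  imports "HOL-Analysis.Analysis"
begin

text \<open>
  Tie-breaking is modelled by a function \<open>tie\<close> on sets, applied to the set of all minimizers.
  The selection property assumed of it, \<open>tie {a, b} \<in> {a, b}\<close> for \<open>a\<close>, \<open>b\<close> in the grid, covers
  sets of one element (\<open>a = b\<close>) or two elements; more than two minimizers over the grid
  cannot occur for \<open>\<bar>x - p\<bar>\<close>, nor for \<open>(norm (b - p *\<^sub>R u))\<^sup>2\<close> with \<open>u \<noteq> 0\<close>.
\<close>

definition grid_argmin :: "(real set \<Rightarrow> real) \<Rightarrow> real set \<Rightarrow> (real \<Rightarrow> real) \<Rightarrow> real" where
  "grid_argmin tie A f = tie {p. is_arg_min f (\<lambda>p. p \<in> A) p}"

definition round_nearest :: "(real set \<Rightarrow> real) \<Rightarrow> real set \<Rightarrow> real \<Rightarrow> real" where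
  "round_nearest tie A x = grid_argmin tie A (\<lambda>p. \<bar>x - p\<bar>)"

text \<open>
  A vector with index set \<open>J\<close> is an extensional function in \<open>J \<rightarrow>\<^sub>E UNIV\<close>, and \<open>L2_set v J\<close> is its
  Euclidean norm. For a least-squares objective \<open>f\<close>, the minimizer of \<open>f\<close> of smallest
  Euclidean norm exists and is unique (it is the Moore--Penrose solution), so the choice made
  by \<open>arg_min\<close> is determined.
\<close>

definition min_norm_argmin :: "nat set \<Rightarrow> ((nat \<Rightarrow> real) \<Rightarrow> real) \<Rightarrow> nat \<Rightarrow> real" where
  "min_norm_argmin J f =
     arg_min (\<lambda>v. L2_set v J) (is_arg_min f (\<lambda>v. v \<in> J \<rightarrow>\<^sub>E UNIV))"

end

theory Submission
  imports Defs
begin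

text \<open>
  For \<open>t \<ge> 2\<close>, \<open>W (t - 1)\<close> solves a least-squares problem, so its residual \<open>r\<close> is orthogonal to
  the columns \<open>t, \<dots>, N\<close>. Both objectives of step \<open>t\<close> in the first procedure are of the form
  \<open>(norm (r + u))\<^sup>2 = (norm r)\<^sup>2 + (norm u)\<^sup>2\<close> with \<open>u\<close> in the span of these columns, so dropping
  \<open>r\<close> leaves the set of minimizers unchanged, and what remains is the objective of the second
  procedure. As the whole sets of minimizers agree, so do the selected elements.
\<close>

lemma is_arg_min_cong:
  assumes "\<And>x y. P x \<Longrightarrow> P y \<Longrightarrow> f x < f y \<longleftrightarrow> g x < g y"
  shows "is_arg_min f P = is_arg_min g P"
  unfolding is_arg_min_def fun_eq_iff using assms by blast

lemma norm_add_sq_orthogonal: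
  fixes r u :: "'a::real_inner"
  assumes "r \<bullet> u = 0"
  shows "(norm (r + u))\<^sup>2 = (norm r)\<^sup>2 + (norm u)\<^sup>2"
  using assms by (intro norm_add_Pythagorean) (simp add: orthogonal_def)

lemma inner_sum_scaleR_eq_0:
  fixes r :: "'a::real_inner"
  assumes "\<forall>j\<in>J. r \<bullet> x j = 0"
  shows "r \<bullet> (\<Sum>j\<in>J. c j *\<^sub>R x j) = 0"
  using assms by (simp add: inner_sum_right)

text \<open>
  With \<open>B\<close> the matrix with columns \<open>x j\<close>, this solves \<open>B\<^sup>T (b - B B\<^sup>T z) = 0\<close>: a vector \<open>u\<close>
  orthogonal to the range of \<open>B B\<^sup>T\<close> satisfies \<open>(norm (B\<^sup>T u))\<^sup>2 = u \<bullet> B B\<^sup>T u = 0\<close>.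
\<close>
lemma normal_equations_solvable:
  fixes x :: "'i \<Rightarrow> 'a::euclidean_space"
  assumes "finite J"
  obtains z where "\<forall>j\<in>J. (b - (\<Sum>i\<in>J. (x i \<bullet> z) *\<^sub>R x i)) \<bullet> x j = 0"
proof -
  define S where "S z = (\<Sum>i\<in>J. (x i \<bullet> z) *\<^sub>R x i)" for z
  have "linear S"
    unfolding S_def
    by (rule linearI)
      (simp_all add: inner_add_right scaleR_add_left sum.distrib scaleR_sum_right)
  then have span: "span (range S) = range S"
    by (simp add: linear_subspace_image span_eq_iff)
  obtain y u where "y \<in> span (range S)" and u: "\<And>v. v \<in> span (range S) \<Longrightarrow> orthogonal u v"
    and b: "b = y + u"
    using orthogonal_subspace_decomp_exists by blast
  then obtain z where z: "y = S z" using span by auto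
  have "0 = u \<bullet> S u" using u[of "S u"] span by (simp add: orthogonal_def)
  also have "\<dots> = (\<Sum>i\<in>J. (x i \<bullet> u)\<^sup>2)"
    by (simp add: S_def inner_sum_right power2_eq_square inner_commute)
  finally have "\<forall>j\<in>J. u \<bullet> x j = 0"
    using assms by (simp add: sum_nonneg_eq_0_iff inner_commute)
  then show thesis using that[of z] b z by (simp add: S_def)
qed

text \<open>Replacing the coefficients \<open>v\<close> by \<open>v'\<close> moves the residual by a
  combination of the \<open>x i\<close>, and the residual of \<open>v\<close> is orthogonal to all
  of these.\<close>

lemma least_squares_pythagoras:
  fixes x :: "'i \<Rightarrow> 'a::real_inner"
  assumes "\<forall>j\<in>J. (b - (\<Sum>i\<in>J. v i *\<^sub>R x i)) \<bullet> x j = 0"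
  shows "(norm (b - (\<Sum>i\<in>J. v' i *\<^sub>R x i)))\<^sup>2 = (norm (b - (\<Sum>i\<in>J. v i *\<^sub>R x i)))\<^sup>2
    + (norm (\<Sum>i\<in>J. (v i - v' i) *\<^sub>R x i))\<^sup>2"
proof -
  have "b - (\<Sum>i\<in>J. v' i *\<^sub>R x i)
      = (b - (\<Sum>i\<in>J. v i *\<^sub>R x i)) + (\<Sum>i\<in>J. (v i - v' i) *\<^sub>R x i)"
    by (simp add: scaleR_diff_left sum_subtractf)
  then show ?thesis
    by (simp only: norm_add_sq_orthogonal[OF inner_sum_scaleR_eq_0[OF assms]])
qed

text \<open>\<open>min_norm_argmin\<close> is a choice, so it is known to be a minimizer only once
  some minimizer of smallest norm has been exhibited. After that, all minimizers share one residual,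
  and the normal equations pass from the witness to the chosen element.\<close>

lemma min_norm_argmin_least_squares_orthogonal:
  fixes x :: "nat \<Rightarrow> 'a::euclidean_space"
  assumes fin: "finite J"
    and f: "f = (\<lambda>v. 1/2 * (norm (b - (\<Sum>i\<in>J. v i *\<^sub>R x i)))\<^sup>2)"
    and "j \<in> J"
  shows "(b - (\<Sum>i\<in>J. min_norm_argmin J f i *\<^sub>R x i)) \<bullet> x j = 0"
proof -
  obtain z where z: "\<forall>j\<in>J. (b - (\<Sum>i\<in>J. (x i \<bullet> z) *\<^sub>R x i)) \<bullet> x j = 0"
    using normal_equations_solvable[OF fin] .
  \<comment> \<open>The coefficients have the form \<open>B\<^sup>T z\<close>, hence are orthogonal
    to the kernel of \<open>B\<close>; this is what gives \<open>v\<close> the smallest norm among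
    the minimizers.\<close>
  define v where "v = restrict (\<lambda>i. x i \<bullet> z) J"
  have v: "v \<in> J \<rightarrow>\<^sub>E UNIV" by (simp add: v_def)
  have orth: "\<forall>j\<in>J. (b - (\<Sum>i\<in>J. v i *\<^sub>R x i)) \<bullet> x j = 0"
    using z by (simp add: v_def)
  have split: "f v' = f v + 1/2 * (norm (\<Sum>i\<in>J. (v i - v' i) *\<^sub>R x i))\<^sup>2" for v'
    using least_squares_pythagoras[OF orth, of v'] by (simp add: f)
  let ?M = "is_arg_min f (\<lambda>v. v \<in> J \<rightarrow>\<^sub>E UNIV)"
  have "f v \<le> f v'" for v' by (simp add: split[of v'])
  with v have Mv: "?M v" by (simp add: is_arg_min_linorder)
  \<comment> \<open>The excess term in \<open>split\<close> has to vanish at a minimizer, so any two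
    minimizers differ by an element of the kernel of \<open>B\<close>.\<close>
  have M_eq: "(\<Sum>i\<in>J. v i *\<^sub>R x i) = (\<Sum>i\<in>J. v' i *\<^sub>R x i)" if "?M v'" for v'
  proof -
    have "f v' \<le> f v" using that v by (auto simp: is_arg_min_linorder)
    then show ?thesis
      by (simp add: split[of v'] scaleR_diff_left sum_subtractf)
  qed
  have "L2_set v J \<le> L2_set v' J" if "?M v'" for v'
  proof -
    \<comment> \<open>Moving \<open>B\<^sup>T\<close> across the inner product turns it into
      \<open>z\<close> against \<open>B (v' - v)\<close>, which is zero.\<close>
    have "(\<Sum>i\<in>J. v i * (v' i - v i)) = z \<bullet> (\<Sum>i\<in>J. (v' i - v i) *\<^sub>R x i)"
      by (simp add: inner_sum_right v_def inner_commute mult.commute)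
    also have "\<dots> = 0"
      using M_eq[OF that] by (simp add: scaleR_diff_left sum_subtractf)
    finally have cross: "(\<Sum>i\<in>J. v i * (v' i - v i)) = 0" .
    have "(v' i)\<^sup>2 = (v i)\<^sup>2 + (v' i - v i)\<^sup>2 + 2 * (v i * (v' i - v i))" for i
      by (simp add: power2_eq_square algebra_simps)
    then have "(\<Sum>i\<in>J. (v' i)\<^sup>2) = (\<Sum>i\<in>J. (v i)\<^sup>2) + (\<Sum>i\<in>J. (v' i - v i)\<^sup>2)"
      by (simp only: sum.distrib sum_distrib_left[symmetric] cross)
    moreover have "0 \<le> (\<Sum>i\<in>J. (v' i - v i)\<^sup>2)" by (simp add: sum_nonneg)
    ultimately show ?thesis by (simp add: L2_set_def)
  qed
  with Mv have "is_arg_min (\<lambda>v. L2_set v J) ?M v"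
    by (simp add: is_arg_min_linorder)
  then have "is_arg_min (\<lambda>v. L2_set v J) ?M (min_norm_argmin J f)"
    unfolding min_norm_argmin_def arg_min_def by (rule someI[where P = "is_arg_min _ _"])
  then have "?M (min_norm_argmin J f)" by (simp add: is_arg_min_def)
  from M_eq[OF this] orth show ?thesis using \<open>j \<in> J\<close> by simp
qed

theorem theorem3p1:
  fixes N :: nat
    and X Xt :: "nat \<Rightarrow> real ^ 'm"
    and w :: "nat \<Rightarrow> real"
    and A :: "real set"
    and tie :: "real set \<Rightarrow> real"
    and q qh :: "nat \<Rightarrow> real"
    and W Wh :: "nat \<Rightarrow> nat \<Rightarrow> real"
    and Xw :: "real ^ 'm"
  defines "Xw \<equiv> \<Sum>j=1..N. w j *\<^sub>R X j"
  assumes cols: "\<forall>j\<in>{1..N}. Xt j \<noteq> 0"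
    and grid: "finite A" "A \<noteq> {}"
    and tie: "\<forall>a\<in>A. \<forall>b\<in>A. tie {a, b} \<in> {a, b}"
    and W_init: "\<forall>j\<in>{1..N}. W 0 j = w j"
    and q_step: "\<forall>t\<in>{1..N}. q t = grid_argmin tie A
      (\<lambda>p. 1/2 * (norm (Xw - (\<Sum>j=1..<t. q j *\<^sub>R Xt j) - p *\<^sub>R Xt t
                          - (\<Sum>j=t+1..N. W (t - 1) j *\<^sub>R Xt j)))\<^sup>2)"
    and W_step: "\<forall>t\<in>{1..N}. W t = min_norm_argmin {t+1..N}
      (\<lambda>v. 1/2 * (norm (Xw - (\<Sum>j=1..t. q j *\<^sub>R Xt j) - (\<Sum>j=t+1..N. v j *\<^sub>R Xt j)))\<^sup>2)"
    and Wh_init: "\<forall>j\<in>{1..N}. Wh 0 j = w j"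
    and qh_first: "qh 1 = grid_argmin tie A
      (\<lambda>p. 1/2 * (norm (Xw - p *\<^sub>R Xt 1 - (\<Sum>j=2..N. w j *\<^sub>R Xt j)))\<^sup>2)"
    and Wh_first: "Wh 1 = min_norm_argmin {2..N}
      (\<lambda>v. 1/2 * (norm (Xw - qh 1 *\<^sub>R Xt 1 - (\<Sum>j=2..N. v j *\<^sub>R Xt j)))\<^sup>2)"
    and qh_step: "\<forall>t\<in>{2..N}. qh t = round_nearest tie A (Wh (t - 1) t)"
    and Wh_step: "\<forall>t\<in>{2..N}. Wh t = min_norm_argmin {t+1..N}
      (\<lambda>v. 1/2 * (norm ((qh t - Wh (t - 1) t) *\<^sub>R Xt t
                          + (\<Sum>j=t+1..N. (v j - Wh (t - 1) j) *\<^sub>R Xt j)))\<^sup>2)"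
  shows "\<forall>t\<in>{1..N}. q t = qh t \<and> (\<forall>j\<in>{t..N}. W (t - 1) j = Wh (t - 1) j)"
proof -
  \<comment> \<open>\<open>r t\<close> is the residual left after step \<open>t\<close>. For
    \<open>t = 0\<close> it need not be orthogonal to any column, since \<open>w\<close> is not
    obtained from a least-squares problem; hence \<open>orth\<close> starts at \<open>1\<close> and
    the reductions below start at step \<open>2\<close>.\<close>
  define r where
    "r t = Xw - (\<Sum>j=1..t. q j *\<^sub>R Xt j) - (\<Sum>j=t+1..N. W t j *\<^sub>R Xt j)" for t
  have orth: "\<forall>j\<in>{t+1..N}. r t \<bullet> Xt j = 0" if "t \<in> {1..N}" for t
    unfolding r_def W_step[rule_format, OF that]
    by (intro ballI min_norm_argmin_least_squares_orthogonal[OF _ refl]) auto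
  have inner: "r (t - 1) \<bullet> Xt t = 0"
      "r (t - 1) \<bullet> (\<Sum>j=t+1..N. c j *\<^sub>R Xt j) = 0" if "t \<in> {2..N}" for t c
  proof -
    have "\<forall>j\<in>{t..N}. r (t - 1) \<bullet> Xt j = 0"
      using orth[of "t - 1"] that by (cases t) auto
    then show "r (t - 1) \<bullet> Xt t = 0"
        "r (t - 1) \<bullet> (\<Sum>j=t+1..N. c j *\<^sub>R Xt j) = 0"
      using that by (auto intro!: inner_sum_scaleR_eq_0)
  qed
  have r_prev: "Xw - (\<Sum>j=1..<t. q j *\<^sub>R Xt j)
      = r (t - 1) + W (t - 1) t *\<^sub>R Xt t + (\<Sum>j=t+1..N. W (t - 1) j *\<^sub>R Xt j)"
    if "t \<in> {2..N}" for t
  proof -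
    have "{1..t - 1} = {1..<t}" "t - 1 + 1 = t" using that by auto
    moreover have "(\<Sum>j=t..N. W (t - 1) j *\<^sub>R Xt j)
        = W (t - 1) t *\<^sub>R Xt t + (\<Sum>j=t+1..N. W (t - 1) j *\<^sub>R Xt j)"
      using that by (simp add: sum.atLeast_Suc_atMost)
    ultimately show ?thesis unfolding r_def by (simp only:) simp
  qed
  have q_round: "q t = round_nearest tie A (W (t - 1) t)" if t: "t \<in> {2..N}" for t
  proof -
    have t1: "t \<in> {1..N}" using t by simp
    have obj: "(norm (Xw - (\<Sum>j=1..<t. q j *\<^sub>R Xt j) - p *\<^sub>R Xt t
        - (\<Sum>j=t+1..N. W (t - 1) j *\<^sub>R Xt j)))\<^sup>2
      = (norm (r (t - 1)))\<^sup>2 + \<bar>W (t - 1) t - p\<bar>\<^sup>2 * (norm (Xt t))\<^sup>2" for p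
    proof -
      have "Xw - (\<Sum>j=1..<t. q j *\<^sub>R Xt j) - p *\<^sub>R Xt t
          - (\<Sum>j=t+1..N. W (t - 1) j *\<^sub>R Xt j) = r (t - 1) + (W (t - 1) t - p) *\<^sub>R Xt t"
        by (simp only: r_prev[OF t]) (simp add: algebra_simps)
      moreover have "r (t - 1) \<bullet> ((W (t - 1) t - p) *\<^sub>R Xt t) = 0"
        using inner(1)[OF t] by simp
      ultimately show ?thesis by (simp add: norm_add_sq_orthogonal power_mult_distrib)
    qed
    \<comment> \<open>As the column is nonzero, the factor \<open>(norm (Xt t))\<^sup>2\<close>
      cancels from the comparison, and squaring preserves the order of absolute values.\<close>
    have "0 < norm (Xt t)" using cols t by simp
    then have less: "1/2 * ((norm (r (t - 1)))\<^sup>2 + \<bar>W (t - 1) t - p\<bar>\<^sup>2 * (norm (Xt t))\<^sup>2)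
        < 1/2 * ((norm (r (t - 1)))\<^sup>2 + \<bar>W (t - 1) t - p'\<bar>\<^sup>2 * (norm (Xt t))\<^sup>2)
      \<longleftrightarrow> \<bar>W (t - 1) t - p\<bar> < \<bar>W (t - 1) t - p'\<bar>" for p p'
      by (simp add: linorder_not_le[symmetric] abs_le_square_iff)
    have argmin_eq: "is_arg_min
        (\<lambda>p. 1/2 * ((norm (r (t - 1)))\<^sup>2 + \<bar>W (t - 1) t - p\<bar>\<^sup>2 * (norm (Xt t))\<^sup>2)) (\<lambda>p. p \<in> A)
      = is_arg_min (\<lambda>p. \<bar>W (t - 1) t - p\<bar>) (\<lambda>p. p \<in> A)"
      by (rule is_arg_min_cong) (rule less)
    have "q t = grid_argmin tie A
        (\<lambda>p. 1/2 * ((norm (r (t - 1)))\<^sup>2 + \<bar>W (t - 1) t - p\<bar>\<^sup>2 * (norm (Xt t))\<^sup>2))"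
      using q_step[rule_format, OF t1] unfolding obj .
    also have "\<dots> = round_nearest tie A (W (t - 1) t)"
      unfolding round_nearest_def grid_argmin_def argmin_eq ..
    finally show ?thesis .
  qed
  have W_update: "W t = min_norm_argmin {t+1..N}
      (\<lambda>v. 1/2 * (norm ((q t - W (t - 1) t) *\<^sub>R Xt t
                          + (\<Sum>j=t+1..N. (v j - W (t - 1) j) *\<^sub>R Xt j)))\<^sup>2)"
    if t: "t \<in> {2..N}" for t
  proof -
    have t1: "t \<in> {1..N}" using t by simp
    define u where "u v = (q t - W (t - 1) t) *\<^sub>R Xt t
      + (\<Sum>j=t+1..N. (v j - W (t - 1) j) *\<^sub>R Xt j)" for v
    have obj: "(norm (Xw - (\<Sum>j=1..t. q j *\<^sub>R Xt j) - (\<Sum>j=t+1..N. v j *\<^sub>R Xt j)))\<^sup>2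
      = (norm (r (t - 1)))\<^sup>2 + (norm (u v))\<^sup>2" for v
    proof -
      have "{1..t} = insert t {1..<t}" using t by auto
      then have "(\<Sum>j=1..t. q j *\<^sub>R Xt j) = (\<Sum>j=1..<t. q j *\<^sub>R Xt j) + q t *\<^sub>R Xt t"
        by simp
      then have "Xw - (\<Sum>j=1..t. q j *\<^sub>R Xt j) - (\<Sum>j=t+1..N. v j *\<^sub>R Xt j)
          = (Xw - (\<Sum>j=1..<t. q j *\<^sub>R Xt j)) - q t *\<^sub>R Xt t - (\<Sum>j=t+1..N. v j *\<^sub>R Xt j)"
        by simp
      \<comment> \<open>The change \<open>u v\<close> of the approximation enters the residual with
        the opposite sign, which its norm does not see.\<close>
      also have "\<dots> = r (t - 1) + - u v"
        by (simp only: r_prev[OF t]) (simp add: u_def scaleR_diff_left sum_subtractf)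
      finally have "Xw - (\<Sum>j=1..t. q j *\<^sub>R Xt j) - (\<Sum>j=t+1..N. v j *\<^sub>R Xt j)
        = r (t - 1) + - u v" .
      moreover have "r (t - 1) \<bullet> - u v = 0"
        using inner[OF t] by (simp add: u_def inner_add_right inner_diff_right)
      ultimately show ?thesis by (simp only: norm_add_sq_orthogonal norm_minus_cancel)
    qed
    have "W t = min_norm_argmin {t+1..N}
        (\<lambda>v. 1/2 * ((norm (r (t - 1)))\<^sup>2 + (norm (u v))\<^sup>2))"
      using W_step[rule_format, OF t1] unfolding obj .
    \<comment> \<open>The constant \<open>(norm (r (t - 1)))\<^sup>2\<close> does not affect
      comparisons, so \<open>arg_min\<close> receives the same predicate on both sides and makes the
      same choice.\<close>
    also have "\<dots> = min_norm_argmin {t+1..N} (\<lambda>v. 1/2 * (norm (u v))\<^sup>2)"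
      unfolding min_norm_argmin_def
      by (intro arg_cong[where f = "arg_min _"] is_arg_min_cong) simp
    finally show ?thesis unfolding u_def .
  qed
  have "q t = qh t \<and> (\<forall>j\<in>{t..N}. W (t - 1) j = Wh (t - 1) j)" if "1 \<le> t" "t \<le> N" for t
    using that
  proof (induction t rule: nat_induct_at_least)
    case base
    \<comment> \<open>\<open>W 0\<close> is known to equal \<open>w\<close> only on the indices
      \<open>1\<close> to \<open>N\<close>, so the replacement is made under the sum.\<close>
    then have "(\<Sum>j=2..N. W 0 j *\<^sub>R Xt j) = (\<Sum>j=2..N. w j *\<^sub>R Xt j)"
      using W_init by (intro sum.cong) auto
    then show ?case
      using base q_step[rule_format, of 1] qh_first W_init Wh_init
      by (simp add: numeral_2_eq_2)
  next
    case (Suc t)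
    then have IH: "q t = qh t" "\<forall>j\<in>{t..N}. W (t - 1) j = Wh (t - 1) j" by auto
    \<comment> \<open>Equality holds as functions on all of \<open>nat\<close>, since both sides are
      \<open>min_norm_argmin\<close> of one and the same objective.\<close>
    have W_eq: "W t = Wh t"
    proof (cases "t = 1")
      case True
      then show ?thesis
        using W_step[rule_format, of 1] Wh_first IH Suc.prems
        by (simp add: numeral_2_eq_2)
    next
      case False
      then have t: "t \<in> {2..N}" using Suc by auto
      \<comment> \<open>The previous weights need to agree only on \<open>t\<close> to
        \<open>N\<close>: the objective depends on no other coordinates of them.\<close>
      have "(\<Sum>j=t+1..N. (v j - W (t - 1) j) *\<^sub>R Xt j)
          = (\<Sum>j=t+1..N. (v j - Wh (t - 1) j) *\<^sub>R Xt j)" for v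
        using IH by (intro sum.cong) auto
      moreover have "W (t - 1) t = Wh (t - 1) t" using IH t by auto
      ultimately show ?thesis
        using W_update[OF t] Wh_step[rule_format, OF t] IH by simp
    qed
    have "Suc t \<in> {2..N}" using Suc by auto
    with W_eq q_round[of "Suc t"] qh_step show ?case by simp
  qed
  then show ?thesis by simp
qed

end
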